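(* Let $n\geq 1$ and let $K_{2,n}$ be the complete bipartite graph with parts $\{v_0,v_1\}$ and $\{v_2,\ldots,v_{n+1}\}$, with sink $v_0$. Its lacking polynomial is $$L_{2,n}(x)=\sum_{k=0}^{n-1}\sum_{i=0}^{k}\binom{n}{i}x^k.$$
   Context: Let $G$ be a finite connected loop-free graph with a distinguished sink vertex $s$. A configuration assigns a non-negative integer $c(v)$ to each non-sink vertex $v$; it is stable if $c(v)<d(v)$ for every non-sink $v$, where $d(v)$ is the degree. For an orientation $\mathcal{O}$ of $G$, $\mathrm{in}_{\mathcal{O}}(v)$ is the number of edges directed into $v$; $c$ is compatible with $\mathcal{O}$ if $\mathrm{in}_{\mathcal{O}}(v)\geq d(v)-c(v)$ for every non-sink $v$. The set $\mathsf{Sto}(G)$ of stochastically recurrent states is the set of stable configurations compatible with at least one orientation of $G$. The lacking polynomial is $L_G(x)=\sum_{c\in\mathsf{Sto}(G)}x^{\ell(c)}$, where $\ell(c)=\sum_{v\neq s}(d(v)-c(v)-1)$. $L_{2,n}$ denotes $L_{K_{2,n}}$ with sink $v_0$. *)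

theory Defs
  imports "HOL-Library.FuncSet" "HOL-Computational_Algebra.Polynomial"
begin

text \<open>Undirected graphs, possibly with multiple edges: \<open>ends G e\<close> is the set of end points of
  the edge \<open>e\<close>.\<close>

record ('v, 'e) ugraph =
  verts :: "'v set"
  edges :: "'e set"
  ends :: "'e \<Rightarrow> 'v set"

definition adjacent :: "('v, 'e) ugraph \<Rightarrow> ('v \<times> 'v) set" where
  "adjacent G = {(u, v). \<exists>e\<in>edges G. ends G e = {u, v}}"

text \<open>The standing assumptions; an edge has two distinct end points exactly because loops are
  excluded.\<close>

definition sink_graph :: "('v, 'e) ugraph \<Rightarrow> 'v \<Rightarrow> bool" where
  "sink_graph G s \<longleftrightarrow>
     finite (verts G) \<and> finite (edges G) \<and> s \<in> verts G \<and>
     (\<forall>e\<in>edges G. ends G e \<subseteq> verts G \<and> card (ends G e) = 2) \<and>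
     (\<forall>u\<in>verts G. \<forall>v\<in>verts G. (u, v) \<in> (adjacent G)\<^sup>*)"

definition vdeg :: "('v, 'e) ugraph \<Rightarrow> 'v \<Rightarrow> nat" where
  "vdeg G v = card {e \<in> edges G. v \<in> ends G e}"

text \<open>A configuration is a function on the non-sink vertices only, hence extensional.\<close>

definition configs :: "('v, 'e) ugraph \<Rightarrow> 'v \<Rightarrow> ('v \<Rightarrow> nat) set" where
  "configs G s = (verts G - {s}) \<rightarrow>\<^sub>E UNIV"

definition stable :: "('v, 'e) ugraph \<Rightarrow> 'v \<Rightarrow> ('v \<Rightarrow> nat) \<Rightarrow> bool" where
  "stable G s c \<longleftrightarrow> (\<forall>v\<in>verts G - {s}. c v < vdeg G v)"

text \<open>An orientation chooses for every edge which of its two end points is the head.\<close>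

definition orientations :: "('v, 'e) ugraph \<Rightarrow> ('e \<Rightarrow> 'v) set" where
  "orientations G = (\<Pi>\<^sub>E e\<in>edges G. ends G e)"

definition indeg :: "('v, 'e) ugraph \<Rightarrow> ('e \<Rightarrow> 'v) \<Rightarrow> 'v \<Rightarrow> nat" where
  "indeg G h v = card {e \<in> edges G. h e = v}"

definition compatible :: "('v, 'e) ugraph \<Rightarrow> 'v \<Rightarrow> ('v \<Rightarrow> nat) \<Rightarrow> ('e \<Rightarrow> 'v) \<Rightarrow> bool" where
  "compatible G s c h \<longleftrightarrow>
     (\<forall>v\<in>verts G - {s}. int (indeg G h v) \<ge> int (vdeg G v) - int (c v))"

definition Sto :: "('v, 'e) ugraph \<Rightarrow> 'v \<Rightarrow> ('v \<Rightarrow> nat) set" where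
  "Sto G s = {c \<in> configs G s. stable G s c \<and> (\<exists>h\<in>orientations G. compatible G s c h)}"

text \<open>The subtraction on \<^typ>\<open>nat\<close> does not truncate on stable configurations, the only ones
  to which \<open>lacking\<close> is applied below.\<close>

definition lacking :: "('v, 'e) ugraph \<Rightarrow> 'v \<Rightarrow> ('v \<Rightarrow> nat) \<Rightarrow> nat" where
  "lacking G s c = (\<Sum>v\<in>verts G - {s}. vdeg G v - c v - 1)"

definition lacking_poly :: "('v, 'e) ugraph \<Rightarrow> 'v \<Rightarrow> int poly" where
  "lacking_poly G s = (\<Sum>c\<in>Sto G s. monom 1 (lacking G s c))"

lemma finite_Sto:
  assumes "sink_graph G s"
  shows "finite (Sto G s)"
proof (rule finite_subset)
  show "Sto G s \<subseteq> (\<Pi>\<^sub>E v\<in>verts G - {s}. {..<vdeg G v})"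
    by (auto simp: Sto_def configs_def stable_def PiE_def)
  show "finite (\<Pi>\<^sub>E v\<in>verts G - {s}. {..<vdeg G v})"
    using assms by (intro finite_PiE) (auto simp: sink_graph_def)
qed

definition complete_bipartite :: "'v set \<Rightarrow> 'v set \<Rightarrow> ('v, 'v set) ugraph" where
  "complete_bipartite A B =
     \<lparr>verts = A \<union> B, edges = {{a, b} |a b. a \<in> A \<and> b \<in> B}, ends = (\<lambda>e. e)\<rparr>"

lemma sink_graph_complete_bipartite:
  assumes "finite A" "finite B" "A \<inter> B = {}" "s \<in> A" "B \<noteq> {}"
  shows "sink_graph (complete_bipartite A B) s"
proof -
  let ?G = "complete_bipartite A B"
  have AB: "(a, b) \<in> adjacent ?G" "(b, a) \<in> adjacent ?G" if "a \<in> A" "b \<in> B" for a b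
    using that by (auto simp: adjacent_def complete_bipartite_def)
  obtain b where b: "b \<in> B" using assms by auto
  have sb: "(s, b) \<in> adjacent ?G" "(b, s) \<in> adjacent ?G" using AB b \<open>s \<in> A\<close> by auto
  have "(u, s) \<in> (adjacent ?G)\<^sup>* \<and> (s, u) \<in> (adjacent ?G)\<^sup>*" if "u \<in> A \<union> B" for u
  proof (cases "u \<in> B")
    case True
    then show ?thesis using AB[OF \<open>s \<in> A\<close>] by blast
  next
    case False
    then have "(u, b) \<in> adjacent ?G" "(b, u) \<in> adjacent ?G" using that AB b by auto
    then show ?thesis using sb by (meson r_into_rtrancl rtrancl.rtrancl_into_rtrancl)
  qed
  then have conn: "(u, v) \<in> (adjacent ?G)\<^sup>*" if "u \<in> A \<union> B" "v \<in> A \<union> B" for u v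
    using that by (meson rtrancl_trans)
  have "{{a, b} |a b. a \<in> A \<and> b \<in> B} = (\<lambda>(a, b). {a, b}) ` (A \<times> B)" by auto
  then have "finite {{a, b} |a b. a \<in> A \<and> b \<in> B}" using assms by simp
  moreover have "card {a, b} = 2" if "a \<in> A" "b \<in> B" for a b
    using that assms(3) by (cases "a = b") auto
  ultimately show ?thesis
    using assms conn unfolding sink_graph_def by (auto simp: complete_bipartite_def)
qed

end

theory Submission
  imports Defs
begin

text \<open>Let \<open>a\<close> be the vertex sharing its part with the sink, \<open>B\<close> the other part of size \<open>n\<close>, and
  \<open>T\<close> the set of vertices of \<open>B\<close> where a stable configuration \<open>c\<close> vanishes (elsewhere on \<open>B\<close> it
  is \<open>1\<close>). A compatible orientation must direct both edges at each vertex of \<open>T\<close> into it; it may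
  direct all other edges at \<open>a\<close> into \<open>a\<close>, since the edge from the sink already serves the vertices
  of \<open>B - T\<close>. So compatibility amounts to \<open>n - card T \<ge> n - c a\<close>. As the lacking number is
  \<open>k = (n - 1 - c a) + card T\<close>, the recurrent states correspond to the pairs \<open>(k, T)\<close> with
  \<open>card T \<le> k \<le> n - 1\<close>.\<close>

text \<open>For fixed \<open>k\<close> this counts the sets \<open>T\<close> that can be paired with
  \<open>k\<close>, giving the inner sum of the polynomial.\<close>

lemma card_subsets_card_le:
  assumes "finite B"
  shows "card {T. T \<subseteq> B \<and> card T \<le> k} = (\<Sum>i = 0..k. card B choose i)"
proof -
  have "{T. T \<subseteq> B \<and> card T \<le> k} = (\<Union>i\<in>{0..k}. {T. T \<subseteq> B \<and> card T = i})" by auto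
  then have "card {T. T \<subseteq> B \<and> card T \<le> k} = (\<Sum>i = 0..k. card {T. T \<subseteq> B \<and> card T = i})"
    using assms by (simp only:, intro card_UN_disjoint) auto
  then show ?thesis using assms by (simp add: n_subsets)
qed

text \<open>The sink \<open>s\<close> and the part \<open>B\<close> are kept abstract, so that no
  interval of numbers enters the argument. \<open>B_nonempty\<close> is the counterpart of
  \<open>n \<ge> 1\<close>.\<close>

locale two_bipartite =
  fixes s a :: 'v and B :: "'v set"
  assumes s_neq_a: "s \<noteq> a" and s_notin: "s \<notin> B" and a_notin: "a \<notin> B"
    and finite_B: "finite B" and B_nonempty: "B \<noteq> {}"
begin

abbreviation K :: "('v, 'v set) ugraph" where
  "K \<equiv> complete_bipartite {s, a} B"

lemma nonsink_verts: "verts K - {s} = insert a B"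
  using s_neq_a s_notin by (auto simp: complete_bipartite_def)

lemma edges_K: "edges K = (\<lambda>b. {s, b}) ` B \<union> (\<lambda>b. {a, b}) ` B"
  by (auto simp: complete_bipartite_def)

lemma ends_K: "ends K e = e"
  by (simp add: complete_bipartite_def)

lemma inj_on_edge: "x \<notin> B \<Longrightarrow> inj_on (\<lambda>b. {x, b}) B"
  by (auto simp: inj_on_def doubleton_eq_iff)

lemma edges_at_a: "{e \<in> edges K. a \<in> e} = (\<lambda>b. {a, b}) ` B"
  using s_neq_a a_notin by (auto simp: edges_K)

lemma edges_at_B:
  assumes "b \<in> B"
  shows "{e \<in> edges K. b \<in> e} = {{s, b}, {a, b}}"
  using assms s_notin a_notin by (auto simp: edges_K)

lemma card_edges_at_B: "card {{s, b}, {a, b}} = 2"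
proof -
  have "{s, b} \<noteq> {a, b}" using s_neq_a by (auto simp: doubleton_eq_iff)
  then show ?thesis by simp
qed

lemma vdeg_a: "vdeg K a = card B"
  unfolding vdeg_def ends_K edges_at_a by (rule card_image) (rule inj_on_edge[OF a_notin])

lemma vdeg_B: "b \<in> B \<Longrightarrow> vdeg K b = 2"
  unfolding vdeg_def ends_K using edges_at_B card_edges_at_B by simp

lemma card_zeros_le_if_compatible:
  assumes h: "h \<in> orientations K" and "compatible K s c h"
  shows "card {b \<in> B. c b = 0} \<le> c a"
proof -
  let ?T = "{b \<in> B. c b = 0}"
  have h_in: "h e \<in> e" if "e \<in> edges K" for e
    using PiE_mem[OF h[unfolded orientations_def] that] by (simp only: ends_K)
  have comp: "int (indeg K h v) \<ge> int (vdeg K v) - int (c v)" if "v \<in> insert a B" for v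
    using assms(2) that unfolding compatible_def nonsink_verts by blast
  have h_T: "h {a, b} = b" if "b \<in> ?T" for b
  proof -
    have b: "b \<in> B" using that by simp
    have sub: "{e \<in> edges K. h e = b} \<subseteq> {{s, b}, {a, b}}"
      using h_in edges_at_B[OF b] by blast
    \<comment> \<open>As \<open>c b = 0\<close> and \<open>b\<close> has degree 2, compatibility
      forces both edges at \<open>b\<close> to point into it.\<close>
    have "card {e \<in> edges K. h e = b} \<ge> 2"
      using comp[of b] that by (simp add: vdeg_B indeg_def)
    then have "{e \<in> edges K. h e = b} = {{s, b}, {a, b}}"
      using sub card_edges_at_B by (intro card_seteq) auto
    then show ?thesis by blast
  qed
  have "{e \<in> edges K. h e = a} \<subseteq> (\<lambda>b. {a, b}) ` (B - ?T)"
  proof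
    fix e assume e: "e \<in> {e \<in> edges K. h e = a}"
    then have "e \<in> {e \<in> edges K. a \<in> e}" using h_in by force
    then obtain b where b: "b \<in> B" "e = {a, b}" unfolding edges_at_a by blast
    then have "b \<notin> ?T" using h_T e a_notin by force
    then show "e \<in> (\<lambda>b. {a, b}) ` (B - ?T)" using b by blast
  qed
  then have "indeg K h a \<le> card (B - ?T)"
    unfolding indeg_def using finite_B
    by (meson card_image_le card_mono finite_Diff finite_imageI le_trans)
  also have "\<dots> = card B - card ?T"
    using finite_B by (intro card_Diff_subset) auto
  \<comment> \<open>Compatibility at \<open>a\<close> bounds its in-degree below by
    \<open>card B - c a\<close>. Since \<open>card ?T \<le> card B\<close>, the difference
    \<open>card B - card ?T\<close> does not truncate.\<close>
  finally show ?thesis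
    using comp[of a] card_mono[OF finite_B, of ?T] by (auto simp: vdeg_a)
qed

lemma compatible_if_card_zeros_le:
  assumes "card {b \<in> B. c b = 0} \<le> c a"
  shows "\<exists>h\<in>orientations K. compatible K s c h"
proof -
  let ?T = "{b \<in> B. c b = 0}"
  \<comment> \<open>Edges between \<open>a\<close> and \<open>B - ?T\<close> point to
    \<open>a\<close>; every other edge points to its end in \<open>B\<close>, which is unique since
    \<open>s\<close> and \<open>a\<close> lie outside \<open>B\<close>.\<close>
  define h where "h = restrict (\<lambda>e.
    if e \<in> (\<lambda>b. {a, b}) ` (B - ?T) then a else THE b. b \<in> e \<inter> B) (edges K)"
  have the_B: "(THE b'. b' \<in> {x, b} \<inter> B) = b" if "b \<in> B" "x \<notin> B" for x b
    using that by (intro the_equality) auto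
  have h_s: "h {s, b} = b" if "b \<in> B" for b
  proof -
    have "{s, b} \<notin> (\<lambda>b. {a, b}) ` (B - ?T)"
      using that s_neq_a s_notin by (auto simp: doubleton_eq_iff)
    then show ?thesis using that the_B[OF that s_notin] by (simp add: h_def edges_K)
  qed
  have h_a: "h {a, b} = (if b \<in> ?T then b else a)" if "b \<in> B" for b
  proof -
    have "{a, b} \<in> (\<lambda>b. {a, b}) ` (B - ?T) \<longleftrightarrow> b \<notin> ?T"
      using that a_notin by (auto simp: doubleton_eq_iff)
    moreover have "{a, b} \<in> edges K" using that by (auto simp: edges_K)
    ultimately show ?thesis using the_B[OF that a_notin] by (simp add: h_def)
  qed
  have "h \<in> orientations K"
    unfolding orientations_def
  proof (rule PiE_I)
    show "h e \<in> ends K e" if "e \<in> edges K" for e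
      using that h_s h_a by (auto simp: edges_K ends_K)
  qed (simp add: h_def)
  moreover have "int (indeg K h v) \<ge> int (vdeg K v) - int (c v)" if "v \<in> insert a B" for v
  proof (cases "v = a")
    case True
    have "card B - card ?T = card (B - ?T)"
      using finite_B by (intro card_Diff_subset[symmetric]) auto
    also have "\<dots> = card ((\<lambda>b. {a, b}) ` (B - ?T))"
      by (intro card_image[symmetric] inj_on_subset[OF inj_on_edge[OF a_notin]]) auto
    also have "\<dots> \<le> indeg K h a"
      unfolding indeg_def using finite_B h_a by (intro card_mono) (auto simp: edges_K)
    finally show ?thesis using assms True by (simp add: vdeg_a)
  next
    case False
    then have v: "v \<in> B" using that by simp
    have fin: "finite {e \<in> edges K. h e = v}" using finite_B by (simp add: edges_K)
    show ?thesis
    proof (cases "c v = 0")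
      case True
      have "{{s, v}, {a, v}} \<subseteq> {e \<in> edges K. h e = v}"
        using v True h_s[OF v] h_a[OF v] by (simp add: edges_K)
      then have "2 \<le> indeg K h v"
        unfolding indeg_def card_edges_at_B[of v, symmetric] by (rule card_mono[OF fin])
      then show ?thesis using v by (simp add: vdeg_B)
    next
      case False
      \<comment> \<open>With \<open>c v\<close> positive, in-degree 1 suffices at \<open>v\<close>,
        and the edge from the sink supplies it.\<close>
      have "{{s, v}} \<subseteq> {e \<in> edges K. h e = v}"
        using v h_s[OF v] by (simp add: edges_K)
      then have "card {{s, v}} \<le> indeg K h v"
        unfolding indeg_def by (rule card_mono[OF fin])
      then show ?thesis using v False by (simp add: vdeg_B)
    qed
  qed
  ultimately show ?thesis unfolding compatible_def nonsink_verts by blast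
qed

lemma Sto_K:
  "Sto K s = {c \<in> insert a B \<rightarrow>\<^sub>E UNIV. c a < card B \<and> (\<forall>b\<in>B. c b < 2) \<and>
     card {b \<in> B. c b = 0} \<le> c a}"
proof -
  have "(\<exists>h\<in>orientations K. compatible K s c h) \<longleftrightarrow> card {b \<in> B. c b = 0} \<le> c a" for c
    using card_zeros_le_if_compatible compatible_if_card_zeros_le by blast
  then show ?thesis
    by (auto simp: Sto_def configs_def stable_def nonsink_verts vdeg_a vdeg_B)
qed

text \<open>A vertex \<open>b\<close> of \<open>B\<close> contributes \<open>2 - c b - 1\<close>,
  which is 1 if \<open>c b = 0\<close> and 0 if \<open>c b = 1\<close>; the first summand comes from
  \<open>a\<close>.\<close>

lemma lacking_K:
  assumes "\<forall>b\<in>B. c b < 2"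
  shows "lacking K s c = (card B - c a - 1) + card {b \<in> B. c b = 0}"
proof -
  have "(\<Sum>b\<in>B. vdeg K b - c b - 1) = (\<Sum>b\<in>B. if c b = 0 then 1 else 0)"
    using assms by (intro sum.cong) (auto simp: vdeg_B)
  also have "\<dots> = card {b \<in> B. c b = 0}"
    using finite_B by (simp add: sum.If_cases Int_def)
  finally show ?thesis
    unfolding lacking_def nonsink_verts using finite_B a_notin by (simp add: vdeg_a)
qed

lemma lacking_poly_K_pairs:
  "lacking_poly K s =
     (\<Sum>(k, T) \<in> (SIGMA k:{0..card B - 1}. {T. T \<subseteq> B \<and> card T \<le> k}). monom 1 k)"
  unfolding lacking_poly_def
proof (rule sum.reindex_bij_witness)
  let ?Z = "\<lambda>c. {b \<in> B. c b = 0}"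
  \<comment> \<open>The value at \<open>a\<close> solves
    \<open>k = (card B - 1 - c a) + card T\<close> for \<open>c a\<close>. Subtracting
    \<open>k\<close> before adding \<open>card T\<close> is exact because
    \<open>k \<le> card B - 1\<close>.\<close>
  let ?i = "\<lambda>(k, T). \<lambda>v\<in>insert a B.
    if v = a then card B - 1 - k + card T else if v \<in> T then 0 else 1 :: nat"
  let ?j = "\<lambda>c. (card B - c a - 1 + card (?Z c), ?Z c)"
  have pos: "card B > 0" using finite_B B_nonempty by (simp add: card_gt_0_iff)
  have Z_i: "?Z (?i (k, T)) = T" if "T \<subseteq> B" for k T
    using that a_notin by auto
  show "?i (?j c) = c" if "c \<in> Sto K s" for c
  proof
    fix v
    have c: "c a < card B" "\<forall>b\<in>B. c b < 2" "card (?Z c) \<le> c a" "c \<in> extensional (insert a B)"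
      using that unfolding Sto_K PiE_def by auto
    show "?i (?j c) v = c v"
    proof (cases "v \<in> insert a B")
      case True
      then show ?thesis using c(1,2,3) by (auto simp: less_2_cases_iff)
    next
      case False
      then show ?thesis using c(4) by (auto simp: extensional_def)
    qed
  qed
  \<comment> \<open>Here the compatibility condition \<open>card (?Z c) \<le> c a\<close> turns into
    \<open>k \<le> card B - 1\<close>.\<close>
  show "?j c \<in> (SIGMA k:{0..card B - 1}. {T. T \<subseteq> B \<and> card T \<le> k})" if "c \<in> Sto K s" for c
    using that unfolding Sto_K by auto
  show "(case ?j c of (k, T) \<Rightarrow> monom 1 k) = monom 1 (lacking K s c)" if "c \<in> Sto K s" for c
    using that by (simp add: Sto_K lacking_K)
  fix p assume "p \<in> (SIGMA k:{0..card B - 1}. {T. T \<subseteq> B \<and> card T \<le> k})"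
  then obtain k T where p: "p = (k, T)" "k \<le> card B - 1" "T \<subseteq> B" "card T \<le> k" by auto
  have i_a: "?i (k, T) a = card B - 1 - k + card T" by simp
  show "?j (?i p) = p"
    using p(2,4) pos unfolding p(1) Z_i[OF p(3)] i_a by simp
  have less_2: "\<forall>b\<in>B. ?i (k, T) b < 2" using a_notin by auto
  have ext: "?i (k, T) \<in> insert a B \<rightarrow>\<^sub>E UNIV" by auto
  \<comment> \<open>The first bound is stability at \<open>a\<close> and rests on
    \<open>card T \<le> k\<close>; the second is compatibility.\<close>
  have bounds: "card B - 1 - k + card T < card B" "card T \<le> card B - 1 - k + card T"
    using p(2,4) pos by auto
  show "?i p \<in> Sto K s"
    unfolding p(1) Sto_K mem_Collect_eq Z_i[OF p(3)] i_a
    by (intro conjI ext less_2 bounds)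
qed

theorem lacking_poly_K:
  "lacking_poly K s = (\<Sum>k = 0..card B - 1. \<Sum>i = 0..k. monom (int (card B choose i)) k)"
proof -
  have "lacking_poly K s = (\<Sum>k = 0..card B - 1. \<Sum>T | T \<subseteq> B \<and> card T \<le> k. monom 1 k)"
    unfolding lacking_poly_K_pairs using finite_B by (intro sum.Sigma[symmetric]) auto
  also have "\<dots> = (\<Sum>k = 0..card B - 1. \<Sum>i = 0..k. monom (int (card B choose i)) k)"
  proof (rule sum.cong[OF refl])
    fix k
    \<comment> \<open>The summand does not depend on \<open>T\<close>, so the sum over
      \<open>T\<close> is a cardinality times \<open>monom 1 k\<close>; this equation moves the
      cardinality into the coefficient.\<close>
    have "of_nat m * monom 1 k = monom (int m) k" for m
      by (simp add: of_nat_monom mult_monom)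
    then show "(\<Sum>T | T \<subseteq> B \<and> card T \<le> k. monom 1 k)
        = (\<Sum>i = 0..k. monom (int (card B choose i)) k)"
      by (simp only: sum_constant card_subsets_card_le[OF finite_B] of_nat_sum monom_sum
          sum_distrib_right)
  qed
  finally show ?thesis .
qed

end

theorem theorem6:
  fixes n :: nat
  assumes "n \<ge> 1"
  shows "lacking_poly (complete_bipartite {0, 1 :: nat} {2..n + 1}) 0 =
           (\<Sum>k = 0..n - 1. \<Sum>i = 0..k. monom (int (n choose i)) k)"
proof -
  interpret two_bipartite 0 1 "{2..n + 1}"
    using assms by unfold_locales auto
  show ?thesis using lacking_poly_K by simp
qed

end
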